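(* Let $u_1,v_1,w_1:[0,\infty)\to[0,\infty)$ be measurable functions such that $v_1$, $w_1$ and $u_1v_1$ are locally integrable, and let $c_1>0$ be a constant. If $$u_1(t)\le c_1+\int_0^t\bigl(u_1(t_1)v_1(t_1)+w_1(t_1)\bigr)\,dt_1\qquad\text{for all } t\ge 0,$$ then $$u_1(t)\le e^{\int_0^t v_1(t_1)\,dt_1}\left[c_1+\rho\left(e^{\int_0^t\frac{w_1(t_1)}{\rho}\,dt_1}-1\right)\right]\qquad\text{for all } t\ge 0\text{ and all }\rho>0.$$ *)

theory Defs
  imports "HOL-Analysis.Analysis"
begin

(* Only compact subsets of S are tested, so on {0..} this includes
   integrability up to the endpoint 0. *)
definition locally_integrable_on :: "(real \<Rightarrow> real) \<Rightarrow> real set \<Rightarrow> bool"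
    (infixr "locally'_integrable'_on" 46)
  where "f locally_integrable_on S \<longleftrightarrow>
    (\<forall>K. compact K \<and> K \<subseteq> S \<longrightarrow> f absolutely_integrable_on K)"

end

theory Submission
  imports Defs
begin

text \<open>
  The bound is Gronwall's inequality in the form \<open>u T \<le> (c + W) exp V\<close>, where \<open>V\<close> and \<open>W\<close>
  are the integrals of \<open>v\<close> and \<open>w\<close> over \<open>[0, T]\<close>. The bracket with \<open>\<rho>\<close> only weakens it,
  since \<open>W \<le> \<rho> (exp (W / \<rho>) - 1)\<close>. As \<open>w \<ge> 0\<close>, its integral up to any
  earlier time is at most \<open>W\<close>, so \<open>w\<close> can be absorbed into the constant \<open>K = c + W\<close>.

  With merely integrable data the usual differentiation of \<open>\<phi> exp (- V)\<close>, where
  \<open>\<phi> t = K + \<integral>\<^sub>0\<^sup>t u v\<close>, would need absolute continuity. It is avoided by using only the increments: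
  as \<open>\<phi>\<close> is nondecreasing and dominates \<open>u\<close>, one has, with
  \<open>V t = \<integral>\<^sub>0\<^sup>t v\<close>, the bound \<open>\<phi> t - \<phi> s \<le> \<phi> t (V t - V s)\<close>, so that \<open>\<phi>\<close> is multiplied by at most \<open>1 / (1 - \<delta>)\<close> while
  \<open>V\<close> grows by \<open>\<delta> < 1\<close>. Cutting \<open>[0, T]\<close> into \<open>n\<close> pieces on which \<open>V\<close> grows
  by \<open>V T / n\<close>, which is possible because \<open>V\<close> is continuous, yields
  \<open>\<phi> T (1 - V T / n) ^ n \<le> K\<close>, and \<open>n \<rightarrow> \<infinity>\<close> gives the exponential
  (\<open>exp_bound_of_increments\<close>, \<open>Gronwall_integrable\<close>).
\<close>

text \<open>
  \<open>k\<close> counts the increments \<open>\<delta>\<close> that are needed to reach the value \<open>V t\<close>. If \<open>V t\<close> exceeds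
  \<open>k \<delta>\<close>, then by the intermediate value theorem \<open>V\<close> takes the value \<open>k \<delta>\<close> at some \<open>s \<le> t\<close>.
  Between \<open>s\<close> and \<open>t\<close> the function \<open>V\<close> grows by at most \<open>\<delta>\<close>, so \<open>\<phi> t (1 - \<delta>) \<le> \<phi> s\<close>, and the
  induction hypothesis applies at \<open>s\<close>.
\<close>

lemma power_bound_of_increments:
  fixes \<phi> V :: "real \<Rightarrow> real"
  assumes cont: "continuous_on {a..b} V"
    and V_a: "V a = 0"
    and nonneg: "\<And>t. t \<in> {a..b} \<Longrightarrow> 0 \<le> \<phi> t"
    and incr: "\<And>s t. a \<le> s \<Longrightarrow> s \<le> t \<Longrightarrow> t \<le> b \<Longrightarrow> \<phi> t - \<phi> s \<le> \<phi> t * (V t - V s)"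
    and \<delta>: "0 \<le> \<delta>" "\<delta> \<le> 1"
    and t: "t \<in> {a..b}" "V t \<le> of_nat k * \<delta>"
  shows "\<phi> t * (1 - \<delta>) ^ k \<le> \<phi> a"
  using t
proof (induction k arbitrary: t)
  case 0
  have "\<phi> t - \<phi> a \<le> \<phi> t * V t"
    using incr[of a t] 0 V_a by simp
  also have "\<dots> \<le> 0"
    using 0 nonneg[of t] by (simp add: mult_nonneg_nonpos)
  finally show ?case by simp
next
  case (Suc k)
  have "\<exists>s\<in>{a..t}. V s \<le> of_nat k * \<delta> \<and> V t - V s \<le> \<delta>"
  proof (cases "V t \<le> of_nat k * \<delta>")
    case True
    then show ?thesis
      using Suc.prems \<delta> by (intro bexI[of _ t]) auto
  next
    case False
    have "\<exists>s\<ge>a. s \<le> t \<and> V s = of_nat k * \<delta>"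
      using False Suc.prems \<delta> V_a continuous_on_subset[OF cont, of "{a..t}"]
      by (intro IVT') auto
    then show ?thesis
      using Suc.prems by (force simp: algebra_simps)
  qed
  then obtain s where s: "s \<in> {a..t}" "V s \<le> of_nat k * \<delta>" "V t - V s \<le> \<delta>"
    by blast
  have "\<phi> t - \<phi> s \<le> \<phi> t * (V t - V s)"
    using incr[of s t] s Suc.prems by simp
  also have "\<dots> \<le> \<phi> t * \<delta>"
    using s nonneg[of t] Suc.prems by (intro mult_left_mono) auto
  finally have "\<phi> t * (1 - \<delta>) \<le> \<phi> s"
    by (simp add: algebra_simps)
  then have "\<phi> t * (1 - \<delta>) * (1 - \<delta>) ^ k \<le> \<phi> s * (1 - \<delta>) ^ k"
    using \<delta> by (intro mult_right_mono) auto
  also have "\<dots> \<le> \<phi> a"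
    using s Suc.prems by (intro Suc.IH) auto
  finally show ?case
    by (simp add: mult.assoc)
qed

lemma exp_bound_of_increments:
  fixes \<phi> V :: "real \<Rightarrow> real"
  assumes "a \<le> b"
    and cont: "continuous_on {a..b} V"
    and V_a: "V a = 0" and V_b: "0 \<le> V b"
    and nonneg: "\<And>t. t \<in> {a..b} \<Longrightarrow> 0 \<le> \<phi> t"
    and incr: "\<And>s t. a \<le> s \<Longrightarrow> s \<le> t \<Longrightarrow> t \<le> b \<Longrightarrow> \<phi> t - \<phi> s \<le> \<phi> t * (V t - V s)"
  shows "\<phi> b \<le> \<phi> a * exp (V b)"
proof -
  have "(\<lambda>n. (1 + (- V b) / real n) ^ n) \<longlonglongrightarrow> exp (- V b)"
    by (rule tendsto_exp_limit_sequentially)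
  then have lim: "(\<lambda>n. \<phi> b * (1 - V b / real n) ^ n) \<longlonglongrightarrow> \<phi> b * exp (- V b)"
    by (intro tendsto_mult_left) simp
  \<comment> \<open>For these \<open>n\<close> the increment \<open>V b / n\<close> is at most 1, so the powers of \<open>1 - V b / n\<close> are nonnegative.\<close>
  have "\<phi> b * (1 - V b / real n) ^ n \<le> \<phi> a" if "nat \<lceil>V b\<rceil> + 1 \<le> n" for n
  proof -
    have "V b \<le> real n" "0 < n"
      using that by linarith+
    then show ?thesis
      using assms by (intro power_bound_of_increments[OF cont V_a nonneg incr]) auto
  qed
  then have "\<phi> b * exp (- V b) \<le> \<phi> a"
    by (intro LIMSEQ_le_const2[OF lim]) blast
  then show ?thesis
    by (simp add: exp_minus field_simps)
qed

text \<open>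
  The increment bound holds because \<open>u r \<le> \<phi> r \<le> \<phi> t\<close> for \<open>r \<le> t\<close>, so \<open>\<phi> t\<close> can be pulled out
  of the integral of \<open>u v\<close> over \<open>[s, t]\<close>.
\<close>

lemma Gronwall_integrable:
  fixes u v :: "real \<Rightarrow> real"
  assumes "a \<le> b" and K: "0 \<le> K"
    and v_int: "v integrable_on {a..b}"
    and uv_int: "(\<lambda>t. u t * v t) integrable_on {a..b}"
    and u_nonneg: "\<And>t. t \<in> {a..b} \<Longrightarrow> 0 \<le> u t"
    and v_nonneg: "\<And>t. t \<in> {a..b} \<Longrightarrow> 0 \<le> v t"
    and ineq: "\<And>t. t \<in> {a..b} \<Longrightarrow> u t \<le> K + integral {a..t} (\<lambda>s. u s * v s)"
  shows "u b \<le> K * exp (integral {a..b} v)"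
proof -
  define \<phi> where "\<phi> t = K + integral {a..t} (\<lambda>s. u s * v s)" for t
  define V where "V t = integral {a..t} v" for t
  have v_sub: "v integrable_on {s..t}"
    and uv_sub: "(\<lambda>t. u t * v t) integrable_on {s..t}" if "a \<le> s" "t \<le> b" for s t
    using that integrable_on_subinterval[OF v_int] integrable_on_subinterval[OF uv_int] by auto
  have V_diff: "V t - V s = integral {s..t} v" if "a \<le> s" "s \<le> t" "t \<le> b" for s t
    using Henstock_Kurzweil_Integration.integral_combine[of a s t v] that v_sub
    by (simp add: V_def)
  have \<phi>_diff: "\<phi> t - \<phi> s = integral {s..t} (\<lambda>s. u s * v s)" if "a \<le> s" "s \<le> t" "t \<le> b" for s t
    using Henstock_Kurzweil_Integration.integral_combine[of a s t "\<lambda>s. u s * v s"] that uv_sub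
    by (simp add: \<phi>_def)
  have incr_nonneg: "0 \<le> integral {s..t} (\<lambda>s. u s * v s)" if "a \<le> s" "t \<le> b" for s t
    using that uv_sub u_nonneg v_nonneg
    by (intro Henstock_Kurzweil_Integration.integral_nonneg) auto
  have incr: "\<phi> t - \<phi> s \<le> \<phi> t * (V t - V s)" if st: "a \<le> s" "s \<le> t" "t \<le> b" for s t
  proof -
    have "u r * v r \<le> \<phi> t * v r" if r: "r \<in> {s..t}" for r
    proof -
      have "u r \<le> \<phi> r"
        using ineq[of r] r st by (simp add: \<phi>_def)
      also have "\<dots> \<le> \<phi> t"
        using \<phi>_diff[of r t] incr_nonneg[of r t] r st by simp
      finally show ?thesis
        using v_nonneg r st by (intro mult_right_mono) auto
    qed
    then have "integral {s..t} (\<lambda>r. u r * v r) \<le> integral {s..t} (\<lambda>r. \<phi> t * v r)"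
      using st uv_sub v_sub by (intro integral_le integrable_on_mult_right) auto
    then show ?thesis
      using st by (simp add: \<phi>_diff V_diff)
  qed
  have "continuous_on {a..b} V"
    unfolding V_def by (rule indefinite_integral_continuous_1[OF v_int])
  moreover have "0 \<le> V b"
    unfolding V_def
    using v_int v_nonneg by (intro Henstock_Kurzweil_Integration.integral_nonneg) auto
  ultimately have "\<phi> b \<le> \<phi> a * exp (V b)"
    using \<open>a \<le> b\<close> K incr_nonneg incr
    by (intro exp_bound_of_increments) (auto simp: V_def \<phi>_def)
  moreover have "u b \<le> \<phi> b"
    using ineq[of b] \<open>a \<le> b\<close> by (simp add: \<phi>_def)
  ultimately show ?thesis
    by (simp add: \<phi>_def V_def)
qed

theorem lemma2p1:
  fixes u v w :: "real \<Rightarrow> real" and c :: real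
  assumes u_meas: "u \<in> borel_measurable (lebesgue_on {0..})"
    and v_meas: "v \<in> borel_measurable (lebesgue_on {0..})"
    and w_meas: "w \<in> borel_measurable (lebesgue_on {0..})"
    and u_nonneg: "\<forall>t\<ge>0. 0 \<le> u t"
    and v_nonneg: "\<forall>t\<ge>0. 0 \<le> v t"
    and w_nonneg: "\<forall>t\<ge>0. 0 \<le> w t"
    and v_int: "v locally_integrable_on {0..}"
    and w_int: "w locally_integrable_on {0..}"
    and uv_int: "(\<lambda>t. u t * v t) locally_integrable_on {0..}"
    and c_pos: "c > 0"
    and ineq: "\<forall>t\<ge>0. u t \<le> c + (LINT s:{0..t}|lebesgue. u s * v s + w s)"
  shows "\<forall>t\<ge>0. \<forall>\<rho>>0.
    u t \<le> exp (LINT s:{0..t}|lebesgue. v s) *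
      (c + \<rho> * (exp (LINT s:{0..t}|lebesgue. w s / \<rho>) - 1))"
proof (intro allI impI)
  fix T \<rho> :: real
  assume T: "0 \<le> T" and \<rho>: "0 < \<rho>"
  have abs_int: "f absolutely_integrable_on {0..t}"
    if "f locally_integrable_on {0..}" for f :: "real \<Rightarrow> real" and t
    using that by (auto simp: locally_integrable_on_def)
  note v_abs = abs_int[OF v_int] and w_abs = abs_int[OF w_int] and uv_abs = abs_int[OF uv_int]
  note HK = set_lebesgue_integral_eq_integral
  define W where "W = integral {0..T} w"
  have W: "0 \<le> W"
    unfolding W_def using HK(1)[OF w_abs] w_nonneg
    by (intro Henstock_Kurzweil_Integration.integral_nonneg) auto
  have "u t \<le> (c + W) + integral {0..t} (\<lambda>s. u s * v s)" if t: "t \<in> {0..T}" for t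
  proof -
    have "(LINT s:{0..t}|lebesgue. u s * v s + w s)
        = integral {0..t} (\<lambda>s. u s * v s) + integral {0..t} w"
      using HK[OF uv_abs] HK[OF w_abs] set_integral_add(2)[OF uv_abs w_abs] by simp
    moreover have "integral {0..t} w \<le> W"
      unfolding W_def using t HK(1)[OF w_abs] w_nonneg by (intro integral_subset_le) auto
    moreover have "u t \<le> c + (LINT s:{0..t}|lebesgue. u s * v s + w s)"
      using ineq t by simp
    ultimately show ?thesis by linarith
  qed
  then have "u T \<le> (c + W) * exp (integral {0..T} v)"
    using T W c_pos HK(1)[OF v_abs] HK(1)[OF uv_abs] u_nonneg v_nonneg
    by (intro Gronwall_integrable) auto
  also have "\<dots> \<le> (c + \<rho> * (exp (W / \<rho>) - 1)) * exp (integral {0..T} v)"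
  proof -
    have "W = \<rho> * (W / \<rho>)"
      using \<rho> by simp
    also have "\<dots> \<le> \<rho> * (exp (W / \<rho>) - 1)"
    proof (rule mult_left_mono)
      show "W / \<rho> \<le> exp (W / \<rho>) - 1"
        using exp_ge_add_one_self[of "W / \<rho>"] by linarith
    qed (use \<rho> in simp)
    finally show ?thesis
      by (intro mult_right_mono) auto
  qed
  also have "W / \<rho> = (LINT s:{0..T}|lebesgue. w s / \<rho>)"
    using HK(2)[OF w_abs] by (simp add: W_def)
  also have "integral {0..T} v = (LINT s:{0..T}|lebesgue. v s)"
    using HK(2)[OF v_abs] by simp
  finally show "u T \<le> exp (LINT s:{0..T}|lebesgue. v s) *
      (c + \<rho> * (exp (LINT s:{0..T}|lebesgue. w s / \<rho>) - 1))"
    by (simp add: mult.commute)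
qed

end
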